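(* Let $q\in\mathbb C$ with $0<|q|<1$ and let $f$ be a function from the positive integers to $\mathbb C$. If the product $\prod_{n=1}^{\infty}(1-f(n)q^n)^{-1}=\frac{1}{\varphi_\infty(f;q)}$ converges, then it may be expressed in each of the following equivalent forms. Write $$A:=\sum_{n=1}^{\infty}q^n\frac{f(n)}{\varphi_n(f;q)},\qquad B:=\frac{1}{\varphi_\infty(f;q)}\sum_{n=1}^\infty q^nf(n)\varphi_{n-1}(f;q),\qquad S:=\sum_{n=1}^{\infty}q^nf(n)\varphi_{n-1}(f;q).$$ Then $$\text{(i)}\quad \frac{1}{\varphi_\infty(f;q)}=\sum_{\lambda\in\mathcal P}q^{|\lambda|}\prod_{\lambda_i\in\lambda}f(\lambda_i);$$ $$\text{(ii)}\quad \frac{1}{\varphi_\infty(f;q)}=1+A;$$ $$\text{(iii)}\quad \frac{1}{\varphi_\infty(f;q)}=1+B;$$ $$\text{(iv)}\quad \frac{1}{\varphi_\infty(f;q)}=1+\sum_{n=1}^\infty\frac{(-1)^n(q^{-1})^{\frac{n(n-1)}{2}}}{\varphi_n\left(\frac1f;q^{-1}\right)\prod_{k=1}^{n-1}f(k)}\quad\text{(provided } f(k)\neq 0 \text{ for all } k\geq 1);$$ $$\text{(v)}\quad \frac{1}{\varphi_\infty(f;q)}=1+\cfrac{S}{1-\cfrac{A}{1+\cfrac{S}{1-\cfrac{A}{1+\cdots}}}}$$ (an infinite continued fraction in which $S$, with sign $+$, and $A$, with sign $-$, alternate as partial numerators).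
   Context: $\mathcal P$ is the set of all integer partitions $\lambda=(\lambda_1,\dots,\lambda_r)$, $\lambda_1\ge\cdots\ge\lambda_r\ge1$, including the empty partition $\emptyset$. The size is $|\lambda|=\lambda_1+\cdots+\lambda_r$, with $|\emptyset|=0$; the product $\prod_{\lambda_i\in\lambda}$ is over the parts of $\lambda$ with multiplicity (empty product $=1$). For a function $f$ on the positive integers and a nonzero complex number $q$, $\varphi_0(f;q):=1$, $\varphi_n(f;q):=\prod_{k=1}^n(1-f(k)q^k)$ for $n\ge1$, and $\varphi_\infty(f;q):=\lim_{n\to\infty}\varphi_n(f;q)$ when the infinite product converges. $\varphi_n(1/f;q^{-1})$ is $\prod_{k=1}^n(1-f(k)^{-1}q^{-k})$.
   Formalization: (i) is asserted when all |f(n)q^n|<1 and sum |f(n)q^n| converges (without the latter, as the limit over partitions with parts at most N); in (v) the infinite fraction is asserted to converge to the value only when |SA|<1 or SA=-1; otherwise both fail. *)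

theory Defs
  imports "HOL-Analysis.Analysis"
begin

text \<open>
  Functions on the positive integers are functions on \<^typ>\<open>nat\<close> whose value at 0 is never used.
\<close>

definition phi :: "(nat \<Rightarrow> complex) \<Rightarrow> complex \<Rightarrow> nat \<Rightarrow> complex" where
  "phi f q n = (\<Prod>k=1..n. 1 - f k * q ^ k)"

definition phi_inf :: "(nat \<Rightarrow> complex) \<Rightarrow> complex \<Rightarrow> complex" where
  "phi_inf f q = lim (\<lambda>n. phi f q n)"

definition partitions :: "nat list set" where
  "partitions = {xs. sorted_wrt (\<ge>) xs \<and> (\<forall>x\<in>set xs. x \<ge> 1)}"

definition partition_term :: "(nat \<Rightarrow> complex) \<Rightarrow> complex \<Rightarrow> nat list \<Rightarrow> complex" where
  "partition_term f q xs = q ^ sum_list xs * prod_list (map f xs)"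

text \<open>
  Continued fractions \<open>1 + a 1 / (1 + a 2 / (1 + a 3 / ...))\<close>.
  \<open>cfrac a n t\<close> is the finite fraction with the \<open>n\<close> partial numerators \<open>a 1, ..., a n\<close> in which the
  rest of the expansion (the innermost denominator) is \<open>t\<close>.
\<close>

primrec cfrac :: "(nat \<Rightarrow> complex) \<Rightarrow> nat \<Rightarrow> complex \<Rightarrow> complex" where
  "cfrac a 0 t = t"
| "cfrac a (Suc n) t = 1 + a 1 / cfrac (\<lambda>k. a (Suc k)) n t"

text \<open>
  Numerator and denominator of the \<open>n\<close>-th approximant, by the Wallis recurrences. The approximants
  are not defined as \<open>cfrac a n 1\<close> because an intermediate denominator may vanish without the
  approximant being undefined (the intermediate value is then infinity, whereas \<open>x / 0 = 0\<close> in HOL);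
  \<open>cf_approximant\<close> below shows that the two agree when no intermediate denominator vanishes.
\<close>

fun cf_num :: "(nat \<Rightarrow> complex) \<Rightarrow> nat \<Rightarrow> complex" where
  "cf_num a 0 = 1"
| "cf_num a (Suc 0) = 1 + a 1"
| "cf_num a (Suc (Suc n)) = cf_num a (Suc n) + a (Suc (Suc n)) * cf_num a n"

fun cf_den :: "(nat \<Rightarrow> complex) \<Rightarrow> nat \<Rightarrow> complex" where
  "cf_den a 0 = 1"
| "cf_den a (Suc 0) = 1"
| "cf_den a (Suc (Suc n)) = cf_den a (Suc n) + a (Suc (Suc n)) * cf_den a n"

definition cf_converges_to :: "(nat \<Rightarrow> complex) \<Rightarrow> complex \<Rightarrow> bool" where
  "cf_converges_to a L \<longleftrightarrow>
     eventually (\<lambda>n. cf_den a n \<noteq> 0) sequentially \<and> (\<lambda>n. cf_num a n / cf_den a n) \<longlonglongrightarrow> L"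

lemma cf_den_Suc: "cf_den a (Suc n) = cf_num (\<lambda>k. a (Suc k)) n"
  by (induction a n rule: cf_num.induct) simp_all

lemma cf_num_Suc:
  "cf_num a (Suc n) = cf_num (\<lambda>k. a (Suc k)) n + a 1 * cf_den (\<lambda>k. a (Suc k)) n"
  by (induction a n rule: cf_num.induct) (simp_all add: algebra_simps)

lemma cf_approximant:
  assumes "\<And>k. 1 \<le> k \<Longrightarrow> k \<le> n \<Longrightarrow> cfrac (\<lambda>j. a (k + j)) (n - k) 1 \<noteq> 0"
  shows "cf_den a n \<noteq> 0 \<and> cfrac a n 1 = cf_num a n / cf_den a n"
  using assms
proof (induction n arbitrary: a)
  case (Suc n)
  let ?b = "\<lambda>k. a (Suc k)"
  have "cfrac (\<lambda>j. ?b (k + j)) (n - k) 1 \<noteq> 0" if "1 \<le> k" "k \<le> n" for k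
    using Suc.prems[of "Suc k"] that by simp
  then have IH: "cf_den ?b n \<noteq> 0" "cfrac ?b n 1 = cf_num ?b n / cf_den ?b n"
    using Suc.IH[of ?b] by auto
  have "cfrac ?b n 1 \<noteq> 0"
    using Suc.prems[of 1] by simp
  then have num: "cf_num ?b n \<noteq> 0"
    using IH by auto
  have "cfrac a (Suc n) 1 = 1 + a 1 / (cf_num ?b n / cf_den ?b n)"
    by (simp only: cfrac.simps IH(2))
  also have "\<dots> = cf_num a (Suc n) / cf_den a (Suc n)"
    using num unfolding cf_den_Suc cf_num_Suc by (simp add: field_simps)
  finally show ?case
    using num unfolding cf_den_Suc by simp
qed simp

text \<open>The partial numerators \<open>S, -A, S, -A, ...\<close>, indexed from 1.\<close>

definition alternating_numerators :: "complex \<Rightarrow> complex \<Rightarrow> nat \<Rightarrow> complex" where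
  "alternating_numerators S A n = (if odd n then S else - A)"

end

theory Submission
  imports Defs
begin

text \<open>
  Everything except (i) rests on two telescoping identities. Writing \<open>P n\<close> for \<open>phi f q n\<close>,
  \<open>q ^ (n+1) * f (n+1) * P n = P n - P (n+1)\<close> gives \<open>S = 1 - P \<infinity>\<close>, and dividing by
  \<open>P n * P (n+1)\<close> gives \<open>A = 1 / P \<infinity> - 1\<close>; the terms of (iv) are those of \<open>A\<close> rewritten.
  For (v) this yields \<open>S - A = - S * A\<close>, so that the Wallis recurrences are solved
  by geometric sums with ratio \<open>- S * A\<close>. For (i), partitions with parts in \<open>{1..N}\<close> are expanded
  by geometric series in the multiplicity of the largest part.
\<close>

section \<open>Sums over partitions\<close>

definition partitions_upto :: "nat \<Rightarrow> nat list set" where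
  "partitions_upto N = {xs \<in> partitions. set xs \<subseteq> {1..N}}"

lemma partitions_upto_0: "partitions_upto 0 = {[]}"
  by (auto simp: partitions_upto_def partitions_def)

lemma partitions_upto_mono: "M \<le> N \<Longrightarrow> partitions_upto M \<subseteq> partitions_upto N"
  by (auto simp: partitions_upto_def)

lemma Union_partitions_upto: "(\<Union>N. partitions_upto N) = partitions"
proof -
  \<comment> \<open>For the empty partition \<open>Max\<close> is unspecified, but any bound
    serves.\<close>
  have "xs \<in> partitions_upto (Max (set xs))" if "xs \<in> partitions" for xs
    using that by (auto simp: partitions_upto_def partitions_def)
  then show ?thesis
    by (auto simp: partitions_upto_def)
qed

text \<open>Parts are weakly decreasing, so the copies of the largest admissible part
  \<open>Suc N\<close> form an initial block; its length and the remaining list determine the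
  partition.\<close>

lemma bij_betw_partitions_upto_Suc:
  "bij_betw (\<lambda>(m, xs). replicate m (Suc N) @ xs) (UNIV \<times> partitions_upto N) (partitions_upto (Suc N))"
proof (rule bij_betwI[where g = "\<lambda>ys. (length (takeWhile ((=) (Suc N)) ys), dropWhile ((=) (Suc N)) ys)"])
  show "(\<lambda>(m, xs). replicate m (Suc N) @ xs) \<in> UNIV \<times> partitions_upto N \<rightarrow> partitions_upto (Suc N)"
  proof (intro funcsetI, clarify)
    fix m xs assume "xs \<in> partitions_upto N"
    then have "sorted_wrt (\<ge>) xs" "\<forall>x\<in>set xs. 1 \<le> x \<and> x \<le> N"
      by (auto simp: partitions_upto_def partitions_def)
    moreover have "sorted_wrt (\<ge>) (replicate m (Suc N))"
      by (induction m) auto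
    ultimately show "replicate m (Suc N) @ xs \<in> partitions_upto (Suc N)"
      by (auto simp: partitions_upto_def partitions_def sorted_wrt_append le_Suc_eq)
  qed
next
  show "(\<lambda>ys. (length (takeWhile ((=) (Suc N)) ys), dropWhile ((=) (Suc N)) ys))
        \<in> partitions_upto (Suc N) \<rightarrow> UNIV \<times> partitions_upto N"
  proof (intro funcsetI SigmaI UNIV_I)
    fix ys assume ys: "ys \<in> partitions_upto (Suc N)"
    \<comment> \<open>If the head is \<open>Suc N\<close> it is dropped and the induction hypothesis
      applies; otherwise it is at most \<open>N\<close> and bounds the whole tail.\<close>
    then show "dropWhile ((=) (Suc N)) ys \<in> partitions_upto N"
    proof (induction ys)
      case (Cons y ys)
      then have "ys \<in> partitions_upto (Suc N)"
        by (auto simp: partitions_upto_def partitions_def)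
      with Cons show ?case
        by (fastforce simp: partitions_upto_def partitions_def)
    qed (simp add: partitions_upto_def partitions_def)
  qed
next
  fix p :: "nat \<times> nat list"
  assume p: "p \<in> UNIV \<times> partitions_upto N"
  obtain m xs where [simp]: "p = (m, xs)" by force
  \<comment> \<open>All parts of \<open>xs\<close> are at most \<open>N\<close>, so
    \<open>takeWhile\<close> stops exactly after the \<open>m\<close> prepended copies.\<close>
  have "Suc N \<notin> set xs"
    using p by (auto simp: partitions_upto_def)
  then have *: "takeWhile ((=) (Suc N)) xs = []" "dropWhile ((=) (Suc N)) xs = xs"
    by (cases xs; simp)+
  have "takeWhile ((=) (Suc N)) (replicate m (Suc N) @ xs) = replicate m (Suc N)"
    "dropWhile ((=) (Suc N)) (replicate m (Suc N) @ xs) = xs"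
    by (induction m) (simp_all add: *)
  then show "(\<lambda>ys. (length (takeWhile ((=) (Suc N)) ys), dropWhile ((=) (Suc N)) ys))
        ((\<lambda>(m, xs). replicate m (Suc N) @ xs) p) = p"
    by simp
next
  fix ys :: "nat list"
  have "replicate (length (takeWhile ((=) (Suc N)) ys)) (Suc N) = takeWhile ((=) (Suc N)) ys"
    by (rule replicate_eqI[symmetric, OF refl]) (auto dest: set_takeWhileD)
  then show "(\<lambda>(m, xs). replicate m (Suc N) @ xs)
        (length (takeWhile ((=) (Suc N)) ys), dropWhile ((=) (Suc N)) ys) = ys"
    by simp
qed

lemma has_sum_geometric:
  fixes z :: "'a :: {real_normed_field, banach}"
  assumes "norm z < 1"
  shows "((\<lambda>n. z ^ n) has_sum inverse (1 - z)) UNIV"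
  using assms norm_summable_imp_has_sum[of "\<lambda>n. z ^ n"] geometric_sums[OF assms]
  by (simp add: norm_power summable_geometric inverse_eq_divide)

text \<open>Both sums go through one induction: the sum of norms supplies the absolute summability
  that lets the second sum be iterated over the multiplicity and the remaining parts.\<close>

lemma has_sum_partitions_upto:
  fixes w :: "nat \<Rightarrow> 'a :: {real_normed_field, banach}"
  assumes w: "\<And>k. 1 \<le> k \<Longrightarrow> k \<le> N \<Longrightarrow> norm (w k) < 1"
  shows "((\<lambda>xs. norm (prod_list (map w xs))) has_sum (\<Prod>k=1..N. inverse (1 - norm (w k)))) (partitions_upto N)"
    and "((\<lambda>xs. prod_list (map w xs)) has_sum (\<Prod>k=1..N. inverse (1 - w k))) (partitions_upto N)"
proof -
  have "((\<lambda>xs. norm (prod_list (map w xs))) has_sum (\<Prod>k=1..N. inverse (1 - norm (w k)))) (partitions_upto N) \<and>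
    ((\<lambda>xs. prod_list (map w xs)) has_sum (\<Prod>k=1..N. inverse (1 - w k))) (partitions_upto N)"
    using w
  proof (induction N)
    case 0
    show ?case
      by (auto simp: partitions_upto_0 has_sum_finite_iff)
  next
    case (Suc N)
    let ?z = "w (Suc N)" and ?W = "\<lambda>xs. prod_list (map w xs)"
    let ?g = "\<lambda>(m, xs). replicate m (Suc N) @ xs"
    have z: "norm ?z < 1"
      using Suc.prems by simp
    have IH: "((\<lambda>xs. norm (?W xs)) has_sum (\<Prod>k=1..N. inverse (1 - norm (w k)))) (partitions_upto N)"
      "(?W has_sum (\<Prod>k=1..N. inverse (1 - w k))) (partitions_upto N)"
      using Suc by simp_all
    have W: "?W (?g p) = ?z ^ fst p * ?W (snd p)" for p
      by (cases p) (simp add: prod_list_replicate)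
    have inner: "((\<lambda>xs. norm (?W (?g (m, xs)))) has_sum (norm ?z ^ m * (\<Prod>k=1..N. inverse (1 - norm (w k))))) (partitions_upto N)"
      "((\<lambda>xs. ?W (?g (m, xs))) has_sum (?z ^ m * (\<Prod>k=1..N. inverse (1 - w k)))) (partitions_upto N)" for m
      unfolding W norm_mult norm_power fst_conv snd_conv by (intro has_sum_cmult_right IH)+
    have outer: "((\<lambda>m. norm ?z ^ m * (\<Prod>k=1..N. inverse (1 - norm (w k)))) has_sum
        (inverse (1 - norm ?z) * (\<Prod>k=1..N. inverse (1 - norm (w k))))) UNIV"
      "((\<lambda>m. ?z ^ m * (\<Prod>k=1..N. inverse (1 - w k))) has_sum
        (inverse (1 - ?z) * (\<Prod>k=1..N. inverse (1 - w k)))) UNIV"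
      using z by (intro has_sum_cmult_left has_sum_geometric; simp)+
    \<comment> \<open>For nonnegative terms, summability of the iterated sum yields summability over
      the product set.\<close>
    have abs: "(\<lambda>p. norm (?W (?g p))) summable_on (UNIV \<times> partitions_upto N)"
      
      using has_sum_imp_summable[OF outer(1)] by (rule summable_on_SigmaI[OF inner(1)]) simp
    have "((\<lambda>p. norm (?W (?g p))) has_sum (\<Prod>k=1..Suc N. inverse (1 - norm (w k)))) (UNIV \<times> partitions_upto N)"
      using has_sum_SigmaI[OF inner(1) outer(1) abs] by (simp add: mult.commute)
    moreover have "((\<lambda>p. ?W (?g p)) has_sum (\<Prod>k=1..Suc N. inverse (1 - w k))) (UNIV \<times> partitions_upto N)"
      using has_sum_SigmaI[OF inner(2) outer(2) abs_summable_summable[OF abs]] by (simp add: mult.commute)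
    ultimately show ?case
      unfolding has_sum_reindex_bij_betw[OF bij_betw_partitions_upto_Suc, of "\<lambda>xs. norm (?W xs)"]
        has_sum_reindex_bij_betw[OF bij_betw_partitions_upto_Suc, of ?W] by (rule conjI)
  qed
  then show "((\<lambda>xs. norm (prod_list (map w xs))) has_sum (\<Prod>k=1..N. inverse (1 - norm (w k)))) (partitions_upto N)"
    and "((\<lambda>xs. prod_list (map w xs)) has_sum (\<Prod>k=1..N. inverse (1 - w k))) (partitions_upto N)"
    by blast+
qed

section \<open>From bounded part size to all partitions\<close>

lemma finite_subset_incseq_Union:
  assumes "incseq A" "finite F" "F \<subseteq> (\<Union>n. A n)"
  shows "\<exists>N::nat. F \<subseteq> A N"
  using assms(2,3)
proof (induction F)
  case (insert x F)
  then obtain M N where "F \<subseteq> A M" "x \<in> A N" by auto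
  then show ?case
    using monoD[OF assms(1), of M "max M N"] monoD[OF assms(1), of N "max M N"]
    by (intro exI[of _ "max M N"]) auto
qed simp

text \<open>Past some finite \<open>F\<close> all finite sums are within \<open>e / 2\<close> of
  \<open>S\<close>. Once \<open>A N\<close> contains \<open>F\<close>, this estimate passes to the
  limit \<open>s N\<close> as a non-strict inequality, which is why \<open>e\<close> is
  halved.\<close>

lemma has_sum_incseq_tendsto:
  fixes f :: "'b \<Rightarrow> 'a :: real_normed_vector"
  assumes A: "incseq A" and s: "\<And>N::nat. (f has_sum s N) (A N)" and S: "(f has_sum S) (\<Union>N. A N)"
  shows "s \<longlonglongrightarrow> S"
proof (rule metric_LIMSEQ_I)
  fix e :: real assume e: "e > 0"
  obtain F where F: "finite F" "F \<subseteq> (\<Union>N. A N)"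
    and close: "\<And>G. finite G \<Longrightarrow> F \<subseteq> G \<Longrightarrow> G \<subseteq> (\<Union>N. A N) \<Longrightarrow> dist (sum f G) S < e / 2"
    using S e unfolding has_sum_def tendsto_iff eventually_finite_subsets_at_top
    by (metis half_gt_zero)
  obtain M where M: "F \<subseteq> A M"
    using finite_subset_incseq_Union[OF A F] by blast
  have "dist (s N) S < e" if N: "N \<ge> M" for N
  proof -
    have "F \<subseteq> A N"
      using M monoD[OF A N] by auto
    then have "eventually (\<lambda>G. dist (sum f G) S \<le> e / 2) (finite_subsets_at_top (A N))"
      unfolding eventually_finite_subsets_at_top
    proof (intro exI[of _ F] conjI allI impI F(1))
      fix G assume "finite G \<and> F \<subseteq> G \<and> G \<subseteq> A N"
      then show "dist (sum f G) S \<le> e / 2"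
        using close[of G] by fastforce
    qed
    moreover have "((\<lambda>G. dist (sum f G) S) \<longlongrightarrow> dist (s N) S) (finite_subsets_at_top (A N))"
      using s[of N] unfolding has_sum_def by (intro tendsto_dist tendsto_const)
    ultimately have "dist (s N) S \<le> e / 2"
      by (intro tendsto_upperbound[where F = "finite_subsets_at_top (A N)"]) auto
    then show ?thesis using e by simp
  qed
  then show "\<exists>M. \<forall>N\<ge>M. dist (s N) S < e" by blast
qed

text \<open>Summability makes the product of the \<open>1 - a k\<close> converge, and as no factor
  vanishes the limit is nonzero; the reciprocal partial products then converge too, hence are
  bounded.\<close>

lemma bounded_prod_inverse_one_minus:
  fixes a :: "nat \<Rightarrow> real"
  assumes a: "\<And>k. 0 \<le> a k" "\<And>k. a k < 1" and "summable a"
  shows "\<exists>C. \<forall>n. (\<Prod>k<n. inverse (1 - a k)) \<le> C"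
proof -
  have "convergent_prod (\<lambda>k. 1 - a k)"
    using assms by (intro abs_convergent_prod_imp_convergent_prod summable_imp_abs_convergent_prod) simp
  moreover have "1 - a k \<noteq> 0" for k
    using a(2)[of k] by simp
  ultimately obtain L where L: "(\<lambda>n. \<Prod>k\<le>n. 1 - a k) \<longlonglongrightarrow> L" "L \<noteq> 0"
    by (subst (asm) convergent_prod_iff_nz_lim) auto
  then have "(\<lambda>n. \<Prod>k<Suc n. inverse (1 - a k)) \<longlonglongrightarrow> inverse L"
    using tendsto_inverse[OF L] by (simp add: prod_inversef[unfolded o_def] lessThan_Suc_atMost)
  then have "(\<lambda>n. \<Prod>k<n. inverse (1 - a k)) \<longlonglongrightarrow> inverse L"
    by (rule LIMSEQ_imp_Suc)
  then have "Bseq (\<lambda>n. \<Prod>k<n. inverse (1 - a k))"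
    by (intro convergent_imp_Bseq convergentI)
  then show ?thesis
    by (metis BseqD abs_le_D1 real_norm_def)
qed

text \<open>Every finite set of partitions lies in some \<open>partitions_upto N\<close>, so its sum
  of norms is at most a product bounded uniformly in \<open>N\<close>. This gives absolute
  summability; the value is then read off along \<open>partitions_upto\<close>.\<close>

lemma has_sum_partitions:
  fixes w :: "nat \<Rightarrow> 'a :: {real_normed_field, banach}"
  assumes w: "\<And>k. 1 \<le> k \<Longrightarrow> norm (w k) < 1"
    and sm: "summable (\<lambda>n. norm (w (Suc n)))"
    and L: "(\<lambda>N. \<Prod>k=1..N. inverse (1 - w k)) \<longlonglongrightarrow> L"
  shows "((\<lambda>xs. prod_list (map w xs)) has_sum L) partitions"
proof -
  let ?W = "\<lambda>xs. prod_list (map w xs)"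
  have inc: "incseq partitions_upto"
    by (auto simp: mono_def dest: partitions_upto_mono)
  obtain C where C: "\<And>n. (\<Prod>k<n. inverse (1 - norm (w (Suc k)))) \<le> C"
    using bounded_prod_inverse_one_minus[of "\<lambda>k. norm (w (Suc k))"] w sm by auto
  have "(\<lambda>xs. norm (?W xs)) summable_on partitions"
  proof (rule nonneg_bdd_above_summable_on)
    show "bdd_above (sum (\<lambda>xs. norm (?W xs)) ` {F. F \<subseteq> partitions \<and> finite F})"
    proof (rule bdd_aboveI2)
      fix F assume "F \<in> {F. F \<subseteq> partitions \<and> finite F}"
      then have F: "finite F" "F \<subseteq> (\<Union>N. partitions_upto N)"
        by (simp_all add: Union_partitions_upto)
      then obtain N where N: "F \<subseteq> partitions_upto N"
        using finite_subset_incseq_Union[OF inc] by blast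
      have "((\<lambda>xs. norm (?W xs)) has_sum (\<Sum>xs\<in>F. norm (?W xs))) F"
        using F by (simp add: has_sum_finite_iff)
      then have "(\<Sum>xs\<in>F. norm (?W xs)) \<le> (\<Prod>k=1..N. inverse (1 - norm (w k)))"
        
      proof (rule has_sum_mono_neutral)
        show "((\<lambda>xs. norm (?W xs)) has_sum (\<Prod>k=1..N. inverse (1 - norm (w k)))) (partitions_upto N)"
          using w by (intro has_sum_partitions_upto)
      qed (use N in auto)
      also have "\<dots> = (\<Prod>k<N. inverse (1 - norm (w (Suc k))))"
        by (rule prod.reindex_bij_witness[of _ Suc "\<lambda>k. k - 1"]) auto
      finally show "(\<Sum>xs\<in>F. norm (?W xs)) \<le> C"
        using C[of N] by simp
    qed
  qed simp
  then have "(?W has_sum infsum ?W partitions) partitions"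
    by (rule has_sum_infsum[OF abs_summable_summable])
  \<comment> \<open>The same finite products tend both to the total sum and to
    \<open>L\<close>.\<close>
  moreover from this have "(\<lambda>N. \<Prod>k=1..N. inverse (1 - w k)) \<longlonglongrightarrow> infsum ?W partitions"
    using w by (intro has_sum_incseq_tendsto[OF inc has_sum_partitions_upto(2)])
      (simp_all only: Union_partitions_upto)
  ultimately show ?thesis
    using LIMSEQ_unique[OF L] by simp
qed

lemma partition_term_eq: "partition_term f q xs = prod_list (map (\<lambda>k. f k * q ^ k) xs)"
  unfolding partition_term_def by (induction xs) (simp_all add: power_add)

section \<open>Telescoping\<close>

lemma phi_0 [simp]: "phi f q 0 = 1"
  by (simp add: phi_def)

lemma phi_Suc: "phi f q (Suc n) = phi f q n * (1 - f (Suc n) * q ^ Suc n)"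
  by (simp add: phi_def)

lemma inverse_phi: "inverse (phi f q n) = (\<Prod>k=1..n. inverse (1 - f k * q ^ k))"
  by (simp add: phi_def prod_inversef[unfolded o_def])

lemma phi_nonzero:
  assumes "\<forall>n\<ge>1. 1 - f n * q ^ n \<noteq> 0"
  shows "phi f q n \<noteq> 0"
  using assms by (simp add: phi_def)

text \<open>\<open>convergent_prod\<close> permits finitely many zero factors. Since none of the
  reciprocals vanishes, their full partial products have a nonzero limit \<open>L\<close>, and
  inverting shows that the \<open>lim\<close> in \<open>phi_inf\<close> is a genuine limit,
  \<open>inverse L\<close>.\<close>

lemma phi_inf_convergence:
  assumes factors: "\<forall>n\<ge>1. 1 - f n * q ^ n \<noteq> 0"
    and conv: "convergent_prod (\<lambda>n. inverse (1 - f (Suc n) * q ^ Suc n))"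
  shows "phi f q \<longlonglongrightarrow> phi_inf f q" and "phi_inf f q \<noteq> 0"
    and "(\<lambda>n. inverse (1 - f (Suc n) * q ^ Suc n)) has_prod (1 / phi_inf f q)"
proof -
  have nz: "inverse (1 - f (Suc n) * q ^ Suc n) \<noteq> 0" for n
    using factors[rule_format, of "Suc n"] by (simp del: power_Suc)
  have partial: "(\<Prod>i\<le>n. inverse (1 - f (Suc i) * q ^ Suc i)) = inverse (phi f q (Suc n))" for n
    unfolding inverse_phi by (rule prod.reindex_bij_witness[of _ "\<lambda>k. k - 1" Suc]) auto
  obtain L where L: "(\<lambda>n. inverse (phi f q (Suc n))) \<longlonglongrightarrow> L" "L \<noteq> 0"
    using conv convergent_prod_iff_nz_lim[of "\<lambda>n. inverse (1 - f (Suc n) * q ^ Suc n)", OF nz]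
    unfolding partial by blast
  have "(\<lambda>n. phi f q (Suc n)) \<longlonglongrightarrow> inverse L"
    using tendsto_inverse[OF L] by simp
  then have "phi f q \<longlonglongrightarrow> inverse L"
    by (rule LIMSEQ_imp_Suc)
  moreover from this have P: "phi_inf f q = inverse L"
    unfolding phi_inf_def by (rule limI)
  ultimately show "phi f q \<longlonglongrightarrow> phi_inf f q" "phi_inf f q \<noteq> 0"
    using L(2) by simp_all
  show "(\<lambda>n. inverse (1 - f (Suc n) * q ^ Suc n)) has_prod (1 / phi_inf f q)"
    using L by (simp add: has_prod_def raw_has_prod_def partial P divide_inverse del: power_Suc)
qed

lemma sums_phi:
  assumes "phi f q \<longlonglongrightarrow> P"
  shows "(\<lambda>n. q ^ Suc n * f (Suc n) * phi f q n) sums (1 - P)"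
proof -
  have "(\<lambda>n. q ^ Suc n * f (Suc n) * phi f q n) = (\<lambda>n. phi f q n - phi f q (Suc n))"
    by (simp add: phi_Suc algebra_simps)
  then show ?thesis
    using telescope_sums'[OF assms] by simp
qed

lemma sums_inverse_phi:
  assumes "phi f q \<longlonglongrightarrow> P" "P \<noteq> 0" and nz: "\<And>n. phi f q n \<noteq> 0"
  shows "(\<lambda>n. q ^ Suc n * (f (Suc n) / phi f q (Suc n))) sums (1 / P - 1)"
proof -
  have "q ^ Suc n * (f (Suc n) / phi f q (Suc n)) = inverse (phi f q (Suc n)) - inverse (phi f q n)" for n
  proof -
    have "q ^ Suc n * f (Suc n) * phi f q n = phi f q n - phi f q (Suc n)"
      by (simp add: phi_Suc algebra_simps)
    then show ?thesis
      using nz[of n] nz[of "Suc n"] by (simp add: divide_simps del: power_Suc) (simp add: algebra_simps)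
  qed
  then show ?thesis
    using telescope_sums[OF tendsto_inverse[OF assms(1,2)]] by (simp add: inverse_eq_divide)
qed

text \<open>Each factor satisfies
  \<open>1 - 1 / (f k * q ^ k) = - (1 - f k * q ^ k) / (f k * q ^ k)\<close>; the exponents of
  \<open>q\<close> add up to 1 + ... + n.\<close>

lemma phi_inverse:
  assumes "q \<noteq> 0" "\<forall>k\<ge>1. f k \<noteq> 0"
  shows "phi (\<lambda>k. 1 / f k) (inverse q) n
    = (- 1) ^ n * phi f q n / ((\<Prod>k=1..n. f k) * q ^ (n * (n + 1) div 2))"
proof (induction n)
  case (Suc n)
  have e: "Suc n * (Suc n + 1) div 2 = n * (n + 1) div 2 + Suc n"
    by simp
  have f: "f (Suc n) \<noteq> 0" "(\<Prod>k=1..n. f k) \<noteq> 0"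
    using assms by auto
  have "1 - 1 / f (Suc n) * inverse q ^ Suc n = - (1 - f (Suc n) * q ^ Suc n) / (f (Suc n) * q ^ Suc n)"
    using f assms(1) by (simp add: field_simps)
  then show ?case
    unfolding phi_Suc[of _ _ n] Suc e power_add
    by (simp add: mult_ac minus_divide_left del: power_Suc) (simp add: algebra_simps)
qed simp

text \<open>After \<open>phi_inverse\<close> the signs cancel, the triangular exponents differ by
  \<open>Suc n\<close>, and of the two products of values of \<open>f\<close> only
  \<open>f (Suc n)\<close> survives, because the explicit one stops at \<open>n\<close>.\<close>

lemma inverse_base_term:
  assumes q: "q \<noteq> 0" and f: "\<forall>k\<ge>1. f k \<noteq> 0" and "phi f q (Suc n) \<noteq> 0"
  shows "(- 1) ^ Suc n * inverse q ^ (Suc n * (Suc n - 1) div 2) /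
      (phi (\<lambda>k. 1 / f k) (inverse q) (Suc n) * (\<Prod>k=1..Suc n - 1. f k))
    = q ^ Suc n * (f (Suc n) / phi f q (Suc n))"
proof -
  have e: "Suc n * (Suc n + 1) div 2 = n * (n + 1) div 2 + Suc n" "Suc n * (Suc n - 1) div 2 = n * (n + 1) div 2"
    by (simp_all add: mult.commute)
  have nz: "(\<Prod>k=1..n. f k) \<noteq> 0" "f (Suc n) \<noteq> 0"
    using f by auto
  show ?thesis
    unfolding phi_inverse[OF q f] e power_add using q nz assms(3)
    by (simp add: divide_simps del: power_Suc)
qed

section \<open>The continued fraction\<close>

text \<open>The two kinds of step exchange \<open>P\<close> and \<open>1 / P\<close>:
  \<open>1 + S / P = 1 / P\<close> and \<open>1 - A / (1 / P) = P\<close>. These are exact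
  identities, independent of convergence.\<close>

lemma cfrac_alternating:
  assumes P: "P \<noteq> 0" and S: "S = 1 - P" and A: "A = 1 / P - 1"
  shows "cfrac (alternating_numerators S A) n (if even n then 1 / P else P) = 1 / P"
proof -
  \<comment> \<open>Dropping the first numerator leaves \<open>- A, S, - A, ...\<close>, whose
    parameters are \<open>- A\<close> and \<open>- S\<close> because the second one enters
    negated.\<close>
  have shift: "(\<lambda>k. alternating_numerators S A (Suc k)) = alternating_numerators (- A) (- S)" for S A
    by (auto simp: alternating_numerators_def)
  have one: "alternating_numerators S A 1 = S" for S A
    by (simp add: alternating_numerators_def)
  \<comment> \<open>The shifted fraction starts in the other phase, so both phases are proved
    together.\<close>
  have "cfrac (alternating_numerators S A) n (if even n then 1 / P else P) = 1 / P \<and>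
      cfrac (alternating_numerators (- A) (- S)) n (if even n then P else 1 / P) = P"
  proof (induction n)
    case (Suc n)
    then show ?case
      using P by (simp only: cfrac.simps shift one even_Suc minus_minus if_not_P if_P split: if_splits)
        (simp_all add: S A field_simps)
  qed simp
  then show ?thesis by blast
qed

text \<open>The hypothesis makes 1 an eigenvalue of the transfer matrix over one period; the other one
  is \<open>S - A\<close>.\<close>

lemma alternating_approximants:
  fixes S A :: complex
  assumes SA: "S - A = - (S * A)"
  defines "G \<equiv> \<lambda>m. \<Sum>i<m. (S - A) ^ i"
  shows "cf_num (alternating_numerators S A) (2 * m) = G (Suc m)"
    and "cf_den (alternating_numerators S A) (2 * m) = 1 - A * G m"
    and "cf_num (alternating_numerators S A) (Suc (2 * m)) = 1 + S * G (Suc m)"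
    and "cf_den (alternating_numerators S A) (Suc (2 * m)) = G (Suc m)"
proof -
  \<comment> \<open>The first term of the geometric sum is split off, with the ratio written as
    \<open>- (S * A)\<close>.\<close>
  have G0: "G 0 = 0" and G: "G (Suc m) = 1 - S * A * G m" for m
    unfolding G_def SA[symmetric] by (simp, subst sum.lessThan_Suc_shift, simp add: SA sum_distrib_left sum_negf)
  have A_eq: "A = S + S * A"
    using SA by (simp add: algebra_simps)
  \<comment> \<open>The Wallis recurrences have order two, so numerators and denominators advance
    together over one period.\<close>
  have "cf_num (alternating_numerators S A) (2 * m) = G (Suc m) \<and>
    cf_den (alternating_numerators S A) (2 * m) = 1 - A * G m \<and>
    cf_num (alternating_numerators S A) (Suc (2 * m)) = 1 + S * G (Suc m) \<and>
    cf_den (alternating_numerators S A) (Suc (2 * m)) = G (Suc m)"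
  proof (induction m)
    case 0
    show ?case by (simp add: G G0 alternating_numerators_def)
  next
    case (Suc m)
    let ?g = "G (Suc m)"
    have partial_numerators: "alternating_numerators S A (Suc (Suc (2 * m))) = - A"
      "alternating_numerators S A (Suc (Suc (Suc (2 * m)))) = S"
      by (simp_all add: alternating_numerators_def)
    have num2: "cf_num (alternating_numerators S A) (2 * Suc m) = 1 + S * ?g - A * ?g"
      and den2: "cf_den (alternating_numerators S A) (2 * Suc m) = ?g - A * (1 - A * G m)"
      using Suc by (simp_all add: partial_numerators)
    \<comment> \<open>The same recursion for \<open>G\<close>, with the ratio now written as
      \<open>S - A\<close>.\<close>
    have n: "1 + S * ?g - A * ?g = G (Suc (Suc m))"
      unfolding G[of "Suc m"] using SA by algebra
    \<comment> \<open>The denominator from the recurrence and the claimed one differ by a multiple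
      of \<open>A - S - S * A\<close>, which \<open>SA\<close> makes zero.\<close>
    have "?g - A * (1 - A * G m) - (1 - A * ?g) = A * G m * (A - S - S * A)"
      unfolding G[of m] by (simp add: algebra_simps)
    also have "A - S - S * A = 0"
      using A_eq by algebra
    finally have d: "?g - A * (1 - A * G m) = 1 - A * ?g"
      by simp
    have "cf_num (alternating_numerators S A) (Suc (2 * Suc m)) = G (Suc (Suc m)) + S * (1 + S * ?g)"
      "cf_den (alternating_numerators S A) (Suc (2 * Suc m)) = 1 - A * ?g + S * ?g"
      using Suc num2 den2 n d by (simp_all add: partial_numerators)
    moreover have "1 - A * ?g + S * ?g = G (Suc (Suc m))"
      using n by (simp add: algebra_simps)
    moreover have "G (Suc (Suc m)) + S * (1 + S * ?g) = 1 + S * G (Suc (Suc m))"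
      unfolding G[of "Suc m"] using A_eq by algebra
    ultimately show ?case
      using num2 den2 n d by simp
  qed
  then show "cf_num (alternating_numerators S A) (2 * m) = G (Suc m)"
    and "cf_den (alternating_numerators S A) (2 * m) = 1 - A * G m"
    and "cf_num (alternating_numerators S A) (Suc (2 * m)) = 1 + S * G (Suc m)"
    and "cf_den (alternating_numerators S A) (Suc (2 * m)) = G (Suc m)"
    by blast+
qed

section \<open>Convergence of the approximants along even and odd indices\<close>

lemma filterlim_even_odd_sequentially:
  fixes X :: "nat \<Rightarrow> 'a"
  assumes "filterlim (\<lambda>n. X (2 * n)) F sequentially" "filterlim (\<lambda>n. X (Suc (2 * n))) F sequentially"
  shows "filterlim X F sequentially"
  unfolding filterlim_iff
proof (intro allI impI)
  fix Q assume "eventually Q F"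
  then obtain M N where M: "\<And>n. n \<ge> M \<Longrightarrow> Q (X (2 * n))" and N: "\<And>n. n \<ge> N \<Longrightarrow> Q (X (Suc (2 * n)))"
    using assms unfolding filterlim_iff eventually_sequentially by meson
  have "Q (X n)" if "n \<ge> 2 * M + 2 * N + 1" for n
  proof (cases "even n")
    case True
    then obtain k where "n = 2 * k" by blast
    then show ?thesis using M[of k] that by simp
  next
    case False
    then obtain k where "n = Suc (2 * k)" by (metis oddE Suc_eq_plus1)
    then show ?thesis using N[of k] that by simp
  qed
  then show "eventually (\<lambda>n. Q (X n)) sequentially"
    unfolding eventually_sequentially by blast
qed

lemma eventually_even_odd_sequentially:
  assumes "eventually (\<lambda>n. Q (2 * n)) sequentially" "eventually (\<lambda>n. Q (Suc (2 * n))) sequentially"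
  shows "eventually Q sequentially"
  \<comment> \<open>For a predicate, tending to \<open>principal {True}\<close> means holding
    eventually.\<close>
  using filterlim_even_odd_sequentially[of Q "principal {True}"] assms by (simp add: filterlim_principal)

text \<open>The approximants are quotients in the geometric sums \<open>G\<close> with ratio
  \<open>w = - (S * A)\<close>. If \<open>norm w < 1\<close> these sums converge; if
  \<open>w = 1\<close> they grow linearly and the quotients tend to ratios of leading
  coefficients.\<close>

lemma cf_converges_to_alternating:
  fixes P S A :: complex
  assumes P: "P \<noteq> 0" and S: "S = 1 - P" and A: "A = 1 / P - 1"
    and SA: "norm (S * A) < 1 \<or> S * A = - 1"
  shows "cf_converges_to (alternating_numerators S A) (1 / P)"
proof -
  define w where "w = S - A"
  define G where "G m = (\<Sum>i<m. w ^ i)" for m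
  have w: "w = - (S * A)"
    unfolding w_def S A using P by (simp add: field_simps)
  note approx = alternating_approximants[of S A, folded w_def, OF w, folded G_def]
  let ?n = "cf_num (alternating_numerators S A)" and ?d = "cf_den (alternating_numerators S A)"
  have "eventually (\<lambda>m. ?d (2 * m) \<noteq> 0) sequentially \<and> eventually (\<lambda>m. ?d (Suc (2 * m)) \<noteq> 0) sequentially \<and>
     (\<lambda>m. ?n (2 * m) / ?d (2 * m)) \<longlonglongrightarrow> 1 / P \<and> (\<lambda>m. ?n (Suc (2 * m)) / ?d (Suc (2 * m))) \<longlonglongrightarrow> 1 / P"
  proof (cases "norm w < 1")
    case True
    then have w1: "1 - w \<noteq> 0" by auto
    have G: "G \<longlonglongrightarrow> 1 / (1 - w)"
      using geometric_sums[OF True] unfolding sums_def G_def[symmetric] .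
    then have G': "(\<lambda>m. G (Suc m)) \<longlonglongrightarrow> 1 / (1 - w)"
      by (rule LIMSEQ_Suc)
    have d0: "(\<lambda>m. 1 - A * G m) \<longlonglongrightarrow> 1 - A * (1 / (1 - w))"
      by (intro tendsto_intros G)
    \<comment> \<open>Since \<open>1 - w - A = 1 - S = P\<close>, the limiting denominator is
      nonzero.\<close>
    have eq: "1 - A * (1 / (1 - w)) = P / (1 - w)"
      using w1 by (simp add: field_simps w_def S)
    have nz: "1 / (1 - w) \<noteq> 0" "1 - A * (1 / (1 - w)) \<noteq> 0"
      using w1 P unfolding eq by auto
    have "(\<lambda>m. G (Suc m) / (1 - A * G m)) \<longlonglongrightarrow> 1 / (1 - w) / (1 - A * (1 / (1 - w)))"
      using d0 G' nz by (intro tendsto_divide)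
    moreover have "1 / (1 - w) / (1 - A * (1 / (1 - w))) = 1 / P"
      unfolding eq using w1 P by simp
    moreover have "(\<lambda>m. (1 + S * G (Suc m)) / G (Suc m)) \<longlonglongrightarrow> (1 + S * (1 / (1 - w))) / (1 / (1 - w))"
      using nz by (intro tendsto_intros G')
    moreover have "(1 + S * (1 / (1 - w))) / (1 / (1 - w)) = 1 / P"
    proof -
      have "(1 + S * (1 / (1 - w))) / (1 / (1 - w)) = 1 - w + S"
        using w1 by (simp add: field_simps)
      then show ?thesis by (simp add: w_def A)
    qed
    ultimately show ?thesis
      unfolding approx using tendsto_imp_eventually_ne[OF d0 nz(2)] tendsto_imp_eventually_ne[OF G' nz(1)]
      by simp
  next
    case False
    then have SA1: "S * A = - 1"
      using SA w by auto
    then have w1: "w = 1" and A0: "A \<noteq> 0"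
      using w by auto
    have G: "G m = of_nat m" for m
      by (simp add: G_def w1)
    \<comment> \<open>From \<open>S - A = w = 1\<close> follows \<open>S = 1 + A\<close>.\<close>
    have SP: "S = 1 / P"
      using w1 unfolding w_def A by (simp add: algebra_simps)
    have lim: "(\<lambda>m. 1 / of_nat (Suc m) :: complex) \<longlonglongrightarrow> 0"
      using LIMSEQ_Suc[OF lim_1_over_n] by simp
    \<comment> \<open>As \<open>A\<close> is nonzero, \<open>A * of_nat m\<close> tends to infinity
      and so eventually avoids 1.\<close>
    have "eventually (\<lambda>m. 1 - A * of_nat m \<noteq> 0) sequentially"
    proof -
      have "filterlim (\<lambda>m. A * of_nat m) at_infinity sequentially"
        using A0 by (intro tendsto_mult_filterlim_at_infinity[OF tendsto_const]) (simp_all add: tendsto_of_nat)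
      then have "eventually (\<lambda>m. A * of_nat m \<noteq> 1) sequentially"
        by (rule filterlim_at_infinity_imp_eventually_ne)
      then show ?thesis by eventually_elim auto
    qed
    moreover have "eventually (\<lambda>m. (of_nat (Suc m) :: complex) \<noteq> 0) sequentially"
      by (simp del: of_nat_Suc)
    moreover have "(\<lambda>m. (1 + S * of_nat (Suc m)) / of_nat (Suc m)) \<longlonglongrightarrow> 1 / P"
    proof -
      have "(\<lambda>m. 1 / of_nat (Suc m) + S) \<longlonglongrightarrow> 0 + S"
        by (intro tendsto_intros lim)
      moreover have "1 / of_nat (Suc m) + S = (1 + S * of_nat (Suc m)) / of_nat (Suc m)" for m
        by (simp add: add_divide_distrib del: of_nat_Suc)
      ultimately show ?thesis by (simp add: SP del: of_nat_Suc)
    qed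
    moreover have "(\<lambda>m. of_nat (Suc m) / (1 - A * of_nat m)) \<longlonglongrightarrow> 1 / P"
    proof -
      \<comment> \<open>Numerator and denominator are divided by \<open>Suc m\<close>, using
        \<open>1 - A * m = (1 + A) - A * Suc m\<close>.\<close>
      have "(\<lambda>m. 1 / ((1 + A) * (1 / of_nat (Suc m)) - A)) \<longlonglongrightarrow> 1 / ((1 + A) * 0 - A)"
        using A0 by (intro tendsto_intros lim) simp
      moreover have "1 / ((1 + A) * (1 / of_nat (Suc m)) - A) = of_nat (Suc m) / (1 - A * of_nat m)" for m
      proof -
        have "(1 + A) * (1 / of_nat (Suc m)) - A = (1 - A * of_nat m) / of_nat (Suc m)"
          by (simp add: divide_simps del: of_nat_Suc) (simp add: algebra_simps)
        then show ?thesis by simp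
      qed
      \<comment> \<open>\<open>S * A = - 1\<close> gives \<open>- 1 / A = S\<close>, and
        \<open>S\<close> is \<open>1 / P\<close> here.\<close>
      moreover have "1 / ((1 + A) * 0 - A) = 1 / P"
        using SA1 A0 unfolding SP[symmetric] by (simp add: field_simps)
      ultimately show ?thesis by (simp del: of_nat_Suc)
    qed
    ultimately show ?thesis
      unfolding approx G by blast
  qed
  then show ?thesis
    unfolding cf_converges_to_def
    by (elim conjE) (rule conjI[OF eventually_even_odd_sequentially filterlim_even_odd_sequentially])
qed

text \<open>The product may converge only conditionally, so (i) gives a limit of sums over bounded
  part size, where \<open>norm (f n * q ^ n) < 1\<close> permits geometric expansion, and a sum over
  all partitions under absolute summability. \<open>suminf\<close> by itself does not assert
  convergence, so (ii) to (iv) state summability. In (v) the finite expansions with tail are exact;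
  the approximants converge when the ratio \<open>- (S * A)\<close> has norm below 1 or equals
  1.\<close>

theorem theorem1p1:
  fixes q :: complex and f :: "nat \<Rightarrow> complex" and A B S :: complex
  assumes q: "0 < norm q" "norm q < 1"
    and factors: "\<forall>n\<ge>1. 1 - f n * q ^ n \<noteq> 0"
    and conv: "convergent_prod (\<lambda>n. inverse (1 - f (Suc n) * q ^ Suc n))"
    and A: "A = (\<Sum>n. q ^ Suc n * (f (Suc n) / phi f q (Suc n)))"
    and B: "B = 1 / phi_inf f q * (\<Sum>n. q ^ Suc n * f (Suc n) * phi f q n)"
    and S: "S = (\<Sum>n. q ^ Suc n * f (Suc n) * phi f q n)"
  shows
    "phi f q \<longlonglongrightarrow> phi_inf f q \<and> phi_inf f q \<noteq> 0 \<and>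
     (\<lambda>n. inverse (1 - f (Suc n) * q ^ Suc n)) has_prod (1 / phi_inf f q)
   \<and> \<comment> \<open>(i)\<close>
     ((\<forall>n\<ge>1. norm (f n * q ^ n) < 1) \<longrightarrow>
        (\<forall>N. partition_term f q summable_on {xs \<in> partitions. set xs \<subseteq> {1..N}}) \<and>
        (\<lambda>N. \<Sum>\<^sub>\<infinity>xs | xs \<in> partitions \<and> set xs \<subseteq> {1..N}. partition_term f q xs)
          \<longlonglongrightarrow> 1 / phi_inf f q \<and>
        (summable (\<lambda>n. norm (f (Suc n) * q ^ Suc n)) \<longrightarrow>
           (partition_term f q has_sum (1 / phi_inf f q)) partitions))
   \<and> \<comment> \<open>(ii)\<close>
     (summable (\<lambda>n. q ^ Suc n * (f (Suc n) / phi f q (Suc n))) \<and>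
      1 / phi_inf f q = 1 + A)
   \<and> \<comment> \<open>(iii)\<close>
     (summable (\<lambda>n. q ^ Suc n * f (Suc n) * phi f q n) \<and>
      1 / phi_inf f q = 1 + B)
   \<and> \<comment> \<open>(iv)\<close>
     ((\<forall>k\<ge>1. f k \<noteq> 0) \<longrightarrow>
        (let t = (\<lambda>n. (- 1) ^ n * inverse q ^ (n * (n - 1) div 2) /
                      (phi (\<lambda>k. 1 / f k) (inverse q) n * (\<Prod>k=1..n - 1. f k)))
         in (\<forall>n\<ge>1. phi (\<lambda>k. 1 / f k) (inverse q) n \<noteq> 0) \<and>
            summable (\<lambda>n. t (Suc n)) \<and>
            1 / phi_inf f q = 1 + (\<Sum>n. t (Suc n))))
   \<and> \<comment> \<open>(v)\<close>
     ((\<forall>n. 1 / phi_inf f q =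
             cfrac (alternating_numerators S A) n
               (if even n then 1 / phi_inf f q else phi_inf f q)) \<and>
      (norm (S * A) < 1 \<or> S * A = - 1 \<longrightarrow>
         cf_converges_to (alternating_numerators S A) (1 / phi_inf f q)))"
proof -
  let ?P = "phi_inf f q"
  note P = phi_inf_convergence[OF factors conv]
  note nz = phi_nonzero[OF factors]
  have q0: "q \<noteq> 0" using q(1) by auto
  note sumS = sums_phi[OF P(1)] and sumA = sums_inverse_phi[OF P(1,2) nz]
  have S': "S = 1 - ?P" and A': "A = 1 / ?P - 1"
    unfolding S A using sumS sumA by (simp_all add: sums_iff)
  have B': "1 / ?P = 1 + B"
    using P(2) unfolding B S[symmetric] S' by (simp add: field_simps)
  have i: "(\<forall>N. partition_term f q summable_on {xs \<in> partitions. set xs \<subseteq> {1..N}}) \<and>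
      (\<lambda>N. \<Sum>\<^sub>\<infinity>xs | xs \<in> partitions \<and> set xs \<subseteq> {1..N}. partition_term f q xs) \<longlonglongrightarrow> 1 / ?P \<and>
      (summable (\<lambda>n. norm (f (Suc n) * q ^ Suc n)) \<longrightarrow>
        (partition_term f q has_sum (1 / ?P)) partitions)"
    if small: "\<forall>n\<ge>1. norm (f n * q ^ n) < 1"
  proof -
    have pt: "partition_term f q = (\<lambda>xs. prod_list (map (\<lambda>k. f k * q ^ k) xs))"
      by (simp add: fun_eq_iff partition_term_eq)
    \<comment> \<open>The sum over part sizes up to \<open>N\<close> is the reciprocal of
      \<open>phi f q N\<close>, so the limit in (i) is that of the reciprocal partial
      products.\<close>
    have fin: "(partition_term f q has_sum inverse (phi f q N)) (partitions_upto N)" for N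
      unfolding pt inverse_phi using small by (intro has_sum_partitions_upto) simp
    have lim: "(\<lambda>N. inverse (phi f q N)) \<longlonglongrightarrow> 1 / ?P"
      using tendsto_inverse[OF P(1,2)] by (simp add: inverse_eq_divide)
    moreover have "(partition_term f q has_sum (1 / ?P)) partitions"
      if "summable (\<lambda>n. norm (f (Suc n) * q ^ Suc n))"
      unfolding pt using small that lim by (intro has_sum_partitions) (simp_all add: inverse_phi)
    ultimately show ?thesis
      using has_sum_imp_summable[OF fin] unfolding infsumI[OF fin] partitions_upto_def[symmetric] by blast
  qed
  have iv: "let t = (\<lambda>n. (- 1) ^ n * inverse q ^ (n * (n - 1) div 2) /
                      (phi (\<lambda>k. 1 / f k) (inverse q) n * (\<Prod>k=1..n - 1. f k)))
         in (\<forall>n\<ge>1. phi (\<lambda>k. 1 / f k) (inverse q) n \<noteq> 0) \<and>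
            summable (\<lambda>n. t (Suc n)) \<and>
            1 / ?P = 1 + (\<Sum>n. t (Suc n))" if f: "\<forall>k\<ge>1. f k \<noteq> 0"
    \<comment> \<open>The closed form \<open>phi_inverse\<close> also shows that the denominators in
      (iv) do not vanish.\<close>
    using sumA nz f q0 unfolding Let_def inverse_base_term[OF q0 f nz]
    by (auto simp: sums_iff phi_inverse[OF q0 f] simp del: power_Suc)
  have A'': "1 / ?P = 1 + A"
    by (simp add: A')
  show ?thesis
    by (intro conjI P sums_summable[OF sumS] sums_summable[OF sumA] A'' B' allI
          cfrac_alternating[OF P(2) S' A', symmetric])
      (rule impI, erule i iv cf_converges_to_alternating[OF P(2) S' A'])+
qed

end
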